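(* Let $\mathcal{P}=\{X_i\mid i\in I\}$ be a partition of a nonempty set $X$ and let $f\in\Omega(X,\mathcal{P})$. Then $f$ is regular in $\Omega(X,\mathcal{P})$ if and only if for every $j\in I\chi^{(f)}$ there exists $i\in I$ such that $f_i\in B(f,I)$ is a map from $X_i$ to $X_j$ (i.e. $i\chi^{(f)}=j$) and $f_i$ is surjective.
   Context: Maps are written to the right of their arguments and composed from left to right; $Af$ denotes the image of $A$ under $f$. A partition $\mathcal{P}=\{X_i\mid i\in I\}$ of $X$ is a collection of nonempty pairwise disjoint subsets (blocks) with union $X$, with distinct indices giving distinct blocks; $E$ is the equivalence relation on $X$ with $(x,y)\in E$ iff $x,y$ lie in the same block. $T(X)$ is the monoid of all selfmaps of $X$ under composition. $T(X,\mathcal{P})=\{f\in T(X)\mid (\forall X_i\in\mathcal{P})(\exists X_j\in\mathcal{P})\ X_if\subseteq X_j\}$, and $\Omega(X,\mathcal{P})=\{f\in T(X,\mathcal{P})\mid (\forall x,y\in X,\ x\neq y)\ (x,y)\in E\Longrightarrow xf\neq yf\}$, a submonoid of $T(X,\mathcal{P})$. An element $x$ of a monoid $M$ is regular in $M$ if there is $y\in M$ with $xyx=x$. For $f\in T(X,\mathcal{P})$, the character $\chi^{(f)}\colon I\to I$ is defined by $i\chi^{(f)}=j$ whenever $X_if\subseteq X_j$. $B(f,I)=\{f_i\mid i\in I\}$, where $f_i\colon X_i\to X_{i\chi^{(f)}}$, $xf_i=xf$, is the map induced by $f$. *)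

theory Defs
  imports "HOL-Algebra.Group" "HOL-Library.Disjoint_Sets" "HOL-Library.FuncSet"
begin

text \<open>Partitions \<open>{P i | i \<in> I}\<close> of \<open>X\<close> in which distinct indices give distinct blocks.\<close>

definition indexed_partition :: "'a set \<Rightarrow> 'i set \<Rightarrow> ('i \<Rightarrow> 'a set) \<Rightarrow> bool" where
  "indexed_partition X I P \<longleftrightarrow> partition_on X (P ` I) \<and> inj_on P I"

definition block_rel :: "'i set \<Rightarrow> ('i \<Rightarrow> 'a set) \<Rightarrow> ('a \<times> 'a) set" where
  "block_rel I P = {(x, y). \<exists>i\<in>I. x \<in> P i \<and> y \<in> P i}"

text \<open>
  Selfmaps of \<open>X\<close> are extensional functions, so that equality of selfmaps is pointwise
  equality on \<open>X\<close>. Maps are composed from left to right: the product of \<open>f\<close> and \<open>g\<close>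
  first applies \<open>f\<close>, whereas \<open>compose X g f\<close> is \<open>x \<mapsto> g (f x)\<close>.
\<close>

definition T_monoid :: "'a set \<Rightarrow> ('a \<Rightarrow> 'a) monoid" where
  "T_monoid X =
     \<lparr>carrier = X \<rightarrow>\<^sub>E X, mult = (\<lambda>f g. compose X g f), one = (\<lambda>x\<in>X. x)\<rparr>"

definition TP_monoid :: "'a set \<Rightarrow> 'i set \<Rightarrow> ('i \<Rightarrow> 'a set) \<Rightarrow> ('a \<Rightarrow> 'a) monoid" where
  "TP_monoid X I P =
     (T_monoid X)\<lparr>carrier := {f \<in> carrier (T_monoid X). \<forall>i\<in>I. \<exists>j\<in>I. f ` P i \<subseteq> P j}\<rparr>"

definition Omega_monoid :: "'a set \<Rightarrow> 'i set \<Rightarrow> ('i \<Rightarrow> 'a set) \<Rightarrow> ('a \<Rightarrow> 'a) monoid" where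
  "Omega_monoid X I P =
     (TP_monoid X I P)\<lparr>carrier := {f \<in> carrier (TP_monoid X I P).
        \<forall>x\<in>X. \<forall>y\<in>X. x \<noteq> y \<longrightarrow> (x, y) \<in> block_rel I P \<longrightarrow> f x \<noteq> f y}\<rparr>"

definition regular_in :: "('a, 'b) monoid_scheme \<Rightarrow> 'a \<Rightarrow> bool" where
  "regular_in M x \<longleftrightarrow> x \<in> carrier M \<and> (\<exists>y\<in>carrier M. x \<otimes>\<^bsub>M\<^esub> y \<otimes>\<^bsub>M\<^esub> x = x)"

text \<open>The index \<open>j\<close> is unique because the blocks are nonempty and pairwise disjoint.\<close>

definition character :: "'i set \<Rightarrow> ('i \<Rightarrow> 'a set) \<Rightarrow> ('a \<Rightarrow> 'a) \<Rightarrow> 'i \<Rightarrow> 'i" where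
  "character I P f = (\<lambda>i\<in>I. THE j. j \<in> I \<and> f ` P i \<subseteq> P j)"

text \<open>
  The map \<open>f\<^sub>i\<close> induced by \<open>f\<close> on \<open>P i\<close>. Its codomain \<open>P (character I P f i)\<close> is not
  recorded in the function and has to be named when speaking of surjectivity.
\<close>

definition induced_map :: "('i \<Rightarrow> 'a set) \<Rightarrow> ('a \<Rightarrow> 'a) \<Rightarrow> 'i \<Rightarrow> 'a \<Rightarrow> 'a" where
  "induced_map P f i = restrict f (P i)"

lemma character_ex1:
  assumes "indexed_partition X I P" and "f \<in> carrier (TP_monoid X I P)" and "i \<in> I"
  shows "\<exists>!j. j \<in> I \<and> f ` P i \<subseteq> P j"
proof -
  have part: "partition_on X (P ` I)" and inj: "inj_on P I"
    using assms(1) by (simp_all add: indexed_partition_def)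
  have "\<exists>j\<in>I. f ` P i \<subseteq> P j"
    using assms(2,3) unfolding TP_monoid_def by simp
  then obtain j where j: "j \<in> I" "f ` P i \<subseteq> P j" ..
  have "P i \<in> P ` I" using assms(3) by (rule imageI)
  then have "P i \<noteq> {}"
    using partition_onD3[OF part] by metis
  then obtain x where x: "x \<in> P i" by blast
  show ?thesis
  proof (rule ex1I)
    show "j \<in> I \<and> f ` P i \<subseteq> P j" using j ..
  next
    fix k assume k: "k \<in> I \<and> f ` P i \<subseteq> P k"
    have "f x \<in> P k \<inter> P j" using x j(2) k by (meson IntI image_subset_iff)
    then have "P k = P j"
      using disjointD[OF partition_onD2[OF part], of "P k" "P j"] j(1) k by (metis emptyE imageI)
    then show "k = j"
      by (rule inj_onD[OF inj]) (use j(1) k in simp_all)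
  qed
qed

lemma monoid_T: "monoid (T_monoid X)"
proof (rule monoidI)
  fix f g h
  assume "f \<in> carrier (T_monoid X)"
  then have "f \<in> X \<rightarrow> X" by (auto simp: T_monoid_def)
  then show "f \<otimes>\<^bsub>T_monoid X\<^esub> g \<otimes>\<^bsub>T_monoid X\<^esub> h
      = f \<otimes>\<^bsub>T_monoid X\<^esub> (g \<otimes>\<^bsub>T_monoid X\<^esub> h)"
    by (simp add: T_monoid_def compose_assoc)
next
  fix f g
  assume "f \<in> carrier (T_monoid X)" "g \<in> carrier (T_monoid X)"
  then show "f \<otimes>\<^bsub>T_monoid X\<^esub> g \<in> carrier (T_monoid X)"
    by (auto simp: T_monoid_def compose_def)
qed (auto simp: T_monoid_def Id_compose compose_Id PiE_def)

lemma submonoid_TP: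
  assumes "indexed_partition X I P"
  shows "submonoid (carrier (TP_monoid X I P)) (T_monoid X)"
proof
  have sub: "P i \<subseteq> X" if "i \<in> I" for i
    using assms that by (auto simp: indexed_partition_def partition_on_def)
  show "carrier (TP_monoid X I P) \<subseteq> carrier (T_monoid X)"
    by (auto simp: TP_monoid_def)
  show "\<one>\<^bsub>T_monoid X\<^esub> \<in> carrier (TP_monoid X I P)"
  proof -
    have "(\<lambda>x\<in>X. x) ` P i \<subseteq> P i" if "i \<in> I" for i
      using sub[OF that] by auto
    then show ?thesis unfolding TP_monoid_def T_monoid_def by auto
  qed
  fix f g
  assume f: "f \<in> carrier (TP_monoid X I P)" and g: "g \<in> carrier (TP_monoid X I P)"
  have "\<exists>k\<in>I. compose X g f ` P i \<subseteq> P k" if i: "i \<in> I" for i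
  proof -
    obtain j where j: "j \<in> I" "f ` P i \<subseteq> P j" using f i by (auto simp: TP_monoid_def)
    obtain k where k: "k \<in> I" "g ` P j \<subseteq> P k" using g j by (auto simp: TP_monoid_def)
    show ?thesis using j k sub[OF i] by (auto simp: compose_def intro!: bexI[of _ k])
  qed
  moreover have "compose X g f \<in> X \<rightarrow>\<^sub>E X"
    using f g by (auto simp: TP_monoid_def T_monoid_def compose_def)
  ultimately show "f \<otimes>\<^bsub>T_monoid X\<^esub> g \<in> carrier (TP_monoid X I P)"
    by (auto simp: TP_monoid_def T_monoid_def)
qed

lemma submonoid_Omega:
  assumes "indexed_partition X I P"
  shows "submonoid (carrier (Omega_monoid X I P)) (TP_monoid X I P)"
proof
  interpret T: submonoid "carrier (TP_monoid X I P)" "T_monoid X"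
    by (rule submonoid_TP[OF assms])
  show "carrier (Omega_monoid X I P) \<subseteq> carrier (TP_monoid X I P)"
    by (auto simp: Omega_monoid_def)
  show "\<one>\<^bsub>TP_monoid X I P\<^esub> \<in> carrier (Omega_monoid X I P)"
    using T.one_closed unfolding Omega_monoid_def by (simp add: TP_monoid_def T_monoid_def)
  fix f g
  assume f: "f \<in> carrier (Omega_monoid X I P)" and g: "g \<in> carrier (Omega_monoid X I P)"
  have mult: "f \<otimes>\<^bsub>TP_monoid X I P\<^esub> g = compose X g f"
    by (simp add: TP_monoid_def T_monoid_def)
  have fTP: "f \<in> carrier (TP_monoid X I P)"
    using f unfolding Omega_monoid_def by simp
  then have fX: "f \<in> X \<rightarrow> X"
    unfolding TP_monoid_def T_monoid_def by auto
  have gTP: "g \<in> carrier (TP_monoid X I P)"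
    using g unfolding Omega_monoid_def by simp
  have ginj: "g u \<noteq> g v"
    if "u \<in> X" "v \<in> X" "u \<noteq> v" "(u, v) \<in> block_rel I P" for u v
    using g that unfolding Omega_monoid_def by simp
  have "compose X g f \<in> carrier (TP_monoid X I P)"
    using T.m_closed[OF fTP gTP] by (simp add: T_monoid_def)
  moreover have "compose X g f x \<noteq> compose X g f y"
    if xy: "x \<in> X" "y \<in> X" "x \<noteq> y" "(x, y) \<in> block_rel I P" for x y
  proof -
    have "f x \<noteq> f y" using f xy unfolding Omega_monoid_def by simp
    moreover have "(f x, f y) \<in> block_rel I P"
    proof -
      obtain i where i: "i \<in> I" "x \<in> P i" "y \<in> P i" using xy by (auto simp: block_rel_def)
      have "\<forall>i\<in>I. \<exists>j\<in>I. f ` P i \<subseteq> P j"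
        using fTP unfolding TP_monoid_def by simp
      then obtain j where "j \<in> I" "f ` P i \<subseteq> P j"
        using i(1) by blast
      then show ?thesis using i unfolding block_rel_def by blast
    qed
    moreover have "f x \<in> X" "f y \<in> X" using fX xy by auto
    ultimately have "g (f x) \<noteq> g (f y)" using ginj by blast
    then show ?thesis using xy by (simp add: compose_def)
  qed
  ultimately show "f \<otimes>\<^bsub>TP_monoid X I P\<^esub> g \<in> carrier (Omega_monoid X I P)"
    unfolding mult Omega_monoid_def by simp
qed

end

(* If g is a regular inverse of f, then h = (x \<mapsto> f (g x)) is idempotent on every block X_j with j
   in the image of the character. Since h maps X_j injectively into itself, it is the identity
   there, so f maps the block containing the g-image of X_j onto X_j. Conversely, a map that is
   injective on blocks and sends X_i onto X_j is a bijection between them; inverting one such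
   bijection for each j in the image of the character, and acting as the identity on all other
   blocks, gives a regular inverse. *)
theory Submission
  imports Defs
begin

lemma indexed_partition_block_subset:
  "indexed_partition X I P \<Longrightarrow> i \<in> I \<Longrightarrow> P i \<subseteq> X"
  by (auto simp: indexed_partition_def partition_on_def)

lemma indexed_partition_block_nonempty:
  "indexed_partition X I P \<Longrightarrow> i \<in> I \<Longrightarrow> P i \<noteq> {}"
  by (metis imageI indexed_partition_def partition_onD3)

lemma indexed_partition_ex_block:
  "indexed_partition X I P \<Longrightarrow> x \<in> X \<Longrightarrow> \<exists>i\<in>I. x \<in> P i"
  by (auto simp: indexed_partition_def partition_on_def)

text \<open>Disjointness makes the two blocks equal, and injectivity of \<open>P\<close> carries
  this over to the indices.\<close>

lemma indexed_partition_index_unique: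
  assumes "indexed_partition X I P" "i \<in> I" "j \<in> I" "x \<in> P i" "x \<in> P j"
  shows "i = j"
proof -
  have "P i = P j"
    using assms disjointD[of "P ` I" "P i" "P j"]
    by (auto simp: indexed_partition_def partition_on_def)
  then show ?thesis
    using assms(1-3) by (auto simp: indexed_partition_def dest: inj_onD)
qed

lemma character_closed_image_subset:
  assumes "indexed_partition X I P" "f \<in> carrier (TP_monoid X I P)" "i \<in> I"
  shows "character I P f i \<in> I" "f ` P i \<subseteq> P (character I P f i)"
  using theI'[OF character_ex1[OF assms]] assms(3) by (simp_all add: character_def)

text \<open>A single point determines the character, since a whole block goes into one block and
  blocks are disjoint.\<close>

lemma character_eqI:
  assumes "indexed_partition X I P" "f \<in> carrier (TP_monoid X I P)"
    and "i \<in> I" "j \<in> I" "x \<in> P i" "f x \<in> P j"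
  shows "character I P f i = j"
  using assms character_closed_image_subset[OF assms(1-3)]
  by (meson image_subset_iff indexed_partition_index_unique)

text \<open>Separating distinct points related by \<open>block_rel\<close> amounts to injectivity on
  each block.\<close>

lemma carrier_Omega_iff:
  assumes "indexed_partition X I P"
  shows "f \<in> carrier (Omega_monoid X I P) \<longleftrightarrow>
    f \<in> X \<rightarrow>\<^sub>E X \<and> (\<forall>i\<in>I. \<exists>j\<in>I. f ` P i \<subseteq> P j) \<and> (\<forall>i\<in>I. inj_on f (P i))"
proof -
  have "(\<forall>x\<in>X. \<forall>y\<in>X. x \<noteq> y \<longrightarrow> (x, y) \<in> block_rel I P \<longrightarrow> f x \<noteq> f y) \<longleftrightarrow>
    (\<forall>i\<in>I. inj_on f (P i))"
    using indexed_partition_block_subset[OF assms]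
    by (fastforce simp: block_rel_def inj_on_def)
  then show ?thesis
    by (simp add: Omega_monoid_def TP_monoid_def T_monoid_def)
qed

text \<open>Both sides of the regularity equation are extensional, so it may be checked pointwise on
  \<open>X\<close>.\<close>

lemma regular_in_Omega_iff:
  "regular_in (Omega_monoid X I P) f \<longleftrightarrow> f \<in> carrier (Omega_monoid X I P) \<and>
    (\<exists>g\<in>carrier (Omega_monoid X I P). \<forall>x\<in>X. f (g (f x)) = f x)"
proof -
  have "f \<otimes>\<^bsub>Omega_monoid X I P\<^esub> g \<otimes>\<^bsub>Omega_monoid X I P\<^esub> f = f \<longleftrightarrow>
      (\<forall>x\<in>X. f (g (f x)) = f x)"
    if "f \<in> carrier (Omega_monoid X I P)" for g
  proof -
    have "f \<in> X \<rightarrow>\<^sub>E X"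
      using that by (simp add: Omega_monoid_def TP_monoid_def T_monoid_def)
    then have "f x \<in> X" if "x \<in> X" "f \<in> extensional X" for x
      using that by auto
    moreover have "f \<in> extensional X"
      using \<open>f \<in> X \<rightarrow>\<^sub>E X\<close> by (simp add: PiE_def)
    ultimately show ?thesis
      by (auto simp: Omega_monoid_def TP_monoid_def T_monoid_def compose_def fun_eq_iff
          extensional_def)
  qed
  then show ?thesis
    by (auto simp: regular_in_def)
qed

text \<open>The required block is the one into which a regular inverse \<open>g\<close> sends
  \<open>P j\<close>.\<close>

lemma regular_in_Omega_imp_surj:
  assumes part: "indexed_partition X I P"
    and reg: "regular_in (Omega_monoid X I P) f"
    and j: "j \<in> character I P f ` I"
  shows "\<exists>i\<in>I. character I P f i = j \<and> f ` P i = P j"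
proof -
  obtain g where f: "f \<in> carrier (Omega_monoid X I P)"
    and g: "g \<in> carrier (Omega_monoid X I P)" and fgf: "\<And>x. x \<in> X \<Longrightarrow> f (g (f x)) = f x"
    using reg by (auto simp: regular_in_Omega_iff)
  have fTP: "f \<in> carrier (TP_monoid X I P)"
    using f by (simp add: Omega_monoid_def)
  note char = character_closed_image_subset[OF part fTP]
  note sub = indexed_partition_block_subset[OF part]
  obtain i where i: "i \<in> I" "j = character I P f i"
    using j by blast
  have jI: "j \<in> I"
    using char(1) i by simp
  obtain x where x: "x \<in> P i"
    using indexed_partition_block_nonempty[OF part i(1)] by blast
  have fx: "f x \<in> P j"
    using char(2)[OF i(1)] x i(2) by blast
  obtain k where k: "k \<in> I" "g ` P j \<subseteq> P k"
    using g jI by (auto simp: carrier_Omega_iff[OF part])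
  \<comment> \<open>A point \<open>f x\<close> of \<open>P j\<close> in the image of
    \<open>f\<close> is fixed by \<open>g\<close> followed by \<open>f\<close>; it shows that
    \<open>f\<close> brings \<open>P k\<close> back into \<open>P j\<close>.\<close>
  have gfx: "g (f x) \<in> P k" "f (g (f x)) \<in> P j"
    using fx k(2) fgf[of x] sub[OF i(1)] x by auto
  have chk: "character I P f k = j"
    by (rule character_eqI[OF part fTP k(1) jI gfx])
  have fk: "f ` P k \<subseteq> P j"
    using char(2)[OF k(1)] chk by simp
  have "f (g y) = y" if y: "y \<in> P j" for y
  proof -
    have gy: "g y \<in> P k"
      using k(2) y by blast
    then have fgy: "f (g y) \<in> P j"
      using fk by blast
    then have gfgy: "g (f (g y)) \<in> P k"
      using k(2) by blast
    have "f (g (f (g y))) = f (g y)"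
      using fgf gy sub[OF k(1)] by blast
    \<comment> \<open>Two cancellations: injectivity of \<open>f\<close> on \<open>P k\<close>
      removes the outer \<open>f\<close>, then injectivity of \<open>g\<close> on \<open>P j\<close>
      removes \<open>g\<close>.\<close>
    then have "g (f (g y)) = g y"
      using f k(1) gy gfgy by (auto simp: carrier_Omega_iff[OF part] dest: inj_onD)
    then show ?thesis
      using g jI fgy y by (auto simp: carrier_Omega_iff[OF part] dest: inj_onD)
  qed
  then have "P j \<subseteq> f ` P k"
    using k(2) by (metis image_eqI image_subset_iff subsetI)
  with fk k(1) chk show ?thesis
    by blast
qed

lemma surj_imp_regular_in_Omega:
  assumes part: "indexed_partition X I P"
    and f: "f \<in> carrier (Omega_monoid X I P)"
    and surj: "\<forall>j \<in> character I P f ` I. \<exists>i\<in>I. f ` P i = P j"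
  shows "regular_in (Omega_monoid X I P) f"
proof -
  define J where "J = character I P f ` I"
  have fTP: "f \<in> carrier (TP_monoid X I P)"
    using f by (simp add: Omega_monoid_def)
  note char = character_closed_image_subset[OF part fTP]
  note sub = indexed_partition_block_subset[OF part]
  obtain s where s: "\<And>j. j \<in> J \<Longrightarrow> s j \<in> I" "\<And>j. j \<in> J \<Longrightarrow> f ` P (s j) = P j"
    using surj unfolding J_def by metis
  obtain b where b: "\<And>x. x \<in> X \<Longrightarrow> b x \<in> I" "\<And>x. x \<in> X \<Longrightarrow> x \<in> P (b x)"
    using indexed_partition_ex_block[OF part] by metis
  have b_eq: "b x = i" if "i \<in> I" "x \<in> P i" for i x
    using that b sub indexed_partition_index_unique[OF part] by (metis subsetD)
  \<comment> \<open>Here \<open>b x\<close> is the index of the block of \<open>x\<close>, and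
    \<open>f\<close> maps block \<open>s j\<close> onto block \<open>j\<close>. Images of different
    blocks under \<open>g\<close> may overlap, which is harmless: injectivity is only required
    within a block.\<close>
  define g where
    "g = (\<lambda>x\<in>X. if b x \<in> J then inv_into (P (s (b x))) f x else x)"
  have g_J: "g x = inv_into (P (s i)) f x" if "i \<in> I" "i \<in> J" "x \<in> P i" for i x
    using that b_eq sub by (auto simp: g_def)
  have g_notJ: "g x = x" if "i \<in> I" "i \<notin> J" "x \<in> P i" for i x
    using that b_eq sub by (auto simp: g_def)
  have block: "\<exists>k\<in>I. g ` P i \<subseteq> P k" and inj: "inj_on g (P i)" if i: "i \<in> I" for i
  proof -
    have "(\<exists>k\<in>I. g ` P i \<subseteq> P k) \<and> inj_on g (P i)"
    proof (cases "i \<in> J")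
      case True
      have "g ` P i \<subseteq> P (s i)"
        using g_J[OF i True] s(2)[OF True] by (auto intro: inv_into_into)
      \<comment> \<open>This rests on surjectivity: \<open>inv_into\<close> is injective on the
        image of \<open>P (s i)\<close> under \<open>f\<close>, which is all of
        \<open>P i\<close>.\<close>
      moreover have "inj_on g (P i)"
        using inj_on_cong[of "P i" g "inv_into (P (s i)) f"] g_J[OF i True] s(2)[OF True]
        by (simp add: inj_on_inv_into)
      ultimately show ?thesis
        using s(1)[OF True] by blast
    next
      case False
      have "g ` P i \<subseteq> P i" "inj_on g (P i)"
        using g_notJ[OF i False] by (auto simp: inj_on_def)
      with i show ?thesis
        by blast
    qed
    then show "\<exists>k\<in>I. g ` P i \<subseteq> P k" "inj_on g (P i)"
      by simp_all
  qed
  have "g x \<in> X" if "x \<in> X" for x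
    using block[OF b(1)[OF that]] b(2)[OF that] sub by blast
  then have "g \<in> X \<rightarrow>\<^sub>E X"
    by (auto simp: g_def)
  with block inj have "g \<in> carrier (Omega_monoid X I P)"
    by (simp add: carrier_Omega_iff[OF part])
  moreover have "f (g (f x)) = f x" if x: "x \<in> X" for x
  proof -
    define j where "j = character I P f (b x)"
    \<comment> \<open>The values of \<open>f\<close> lie only in blocks with index in
      \<open>J\<close>, so \<open>g\<close> acts on \<open>f x\<close> through its
      \<open>inv_into\<close> branch, which \<open>f\<close> undoes.\<close>
    have j: "j \<in> J" "j \<in> I" "f x \<in> P j"
      using b[OF x] char[of "b x"] by (auto simp: J_def j_def)
    then show ?thesis
      using g_J[of j "f x"] s(2)[of j] by (simp add: f_inv_into_f)
  qed
  ultimately show ?thesis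
    using f by (auto simp: regular_in_Omega_iff)
qed

theorem theorem6p2:
  fixes X :: "'a set" and I :: "'i set" and P :: "'i \<Rightarrow> 'a set" and f :: "'a \<Rightarrow> 'a"
  assumes "X \<noteq> {}"
    and "indexed_partition X I P"
    and "f \<in> carrier (Omega_monoid X I P)"
  shows "regular_in (Omega_monoid X I P) f \<longleftrightarrow>
    (\<forall>j \<in> character I P f ` I. \<exists>i\<in>I. character I P f i = j \<and> induced_map P f i ` P i = P j)"
proof -
  have "induced_map P f i ` P i = f ` P i" for i
    by (simp add: induced_map_def)
  then show ?thesis
    using regular_in_Omega_imp_surj[OF assms(2)] surj_imp_regular_in_Omega[OF assms(2,3)]
    by metis
qed

end
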